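(* Let $n\ge 9$ be a natural number and $G\in\{\mathrm{A}_n,\mathrm{S}_n\}$. The proportion of elements $x\in G$ (among all elements of $G$) that have even order and satisfy $\big|\operatorname{supp} x^{|x|/2}\big|\le 4\sqrt{n}/3$ is at least $(13\log(n))^{-1}$.
   Context: $\mathrm{A}_n$ and $\mathrm{S}_n$ are the alternating and symmetric groups on $\{1,\dots,n\}$; $\log$ is the natural logarithm; $|x|$ is the order of $x$; $\operatorname{supp}\pi=\{i: i^\pi\neq i\}$ is the set of points moved by $\pi$. *)

theory Defs
  imports Complex_Main "HOL-Algebra.Sym_Groups" "HOL-Algebra.Multiplicative_Group"
begin

definition supp :: "('a \<Rightarrow> 'a) \<Rightarrow> 'a set"
  where "supp p = {i. p i \<noteq> i}"

end

theory Submission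
  imports Defs "HOL-Analysis.Harmonic_Numbers"
begin

text \<open>
  Choose \<open>m = 2 ^ k\<close> as large as possible subject to \<open>m \<le> 4 * sqrt n / 3\<close> and \<open>m \<le> 4 * ln n\<close>
  (for \<open>n < 36\<close> simply \<open>m = 4\<close>). If exactly one cycle of \<open>x\<close> has length divisible by \<open>m\<close>, and this
  cycle is an \<open>m\<close>-cycle, then \<open>x\<close> has even order and its power to half the order moves only points of
  that cycle. Such an \<open>x\<close> is an \<open>m\<close>-cycle times a permutation of the remaining \<open>N = n - m\<close>
  points without cycles of length divisible by \<open>m\<close>. Among the permutations of \<open>N\<close> points of a given
  sign, the expected number of \<open>l\<close>-cycles is at most \<open>1 / l\<close>, or \<open>2 / l\<close> if \<open>l \<ge> N - 1\<close>; a union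
  bound over the multiples \<open>l\<close> of \<open>m\<close> shows that the proportion of permutations to be discarded is
  at most \<open>(1 + H) / m\<close>, where \<open>H\<close> is the harmonic number of \<open>N div m\<close>. So for each sign the wanted
  proportion is at least \<open>(1 - (1 + H) / m) / m\<close>. Fixing the sign throughout settles the alternating
  and the symmetric group simultaneously.
\<close>

subsection \<open>Cycles and least powers\<close>

lemma sign_cycle_of_list:
  assumes "distinct cs" "cs \<noteq> []"
  shows "sign (cycle_of_list cs) = (-1) ^ (length cs - 1)"
  using assms
proof (induction cs rule: cycle_of_list.induct)
  case (1 i j cs)
  then show ?case
    using sign_compose[OF permutation_swap_id permutation_of_cycle, of i j "j # cs"]
    by (auto simp: sign_swap_id comp_def)
qed (auto simp: id_def[symmetric])

lemma funpow_cycle_of_list_nth: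
  assumes "distinct cs" "j < length cs"
  shows "(cycle_of_list cs ^^ k) (cs ! j) = cs ! ((j + k) mod length cs)"
proof -
  have "(cycle_of_list cs ^^ k) (cs ! j) = map (cycle_of_list cs ^^ k) cs ! j"
    using assms by simp
  also have "\<dots> = cs ! ((j + k) mod length cs)"
    unfolding cyclic_rotation[OF assms(1)] using assms(2) by (simp add: nth_rotate add.commute)
  finally show ?thesis .
qed

text \<open>The exponents that fix \<open>i\<close> are the multiples of its least power. On the
  cycle they are also the multiples of the length, and two numbers with the same multiples are
  equal.\<close>

lemma least_power_cycle_of_list:
  assumes "distinct cs" "i \<in> set cs"
  shows "least_power (cycle_of_list cs) i = length cs"
proof -
  obtain j where j: "j < length cs" "i = cs ! j"
    using assms(2) by (metis in_set_conv_nth)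
  have "(cycle_of_list cs ^^ k) i = i \<longleftrightarrow> length cs dvd k" for k
  proof -
    have "(cycle_of_list cs ^^ k) i = i \<longleftrightarrow> (j + k) mod length cs = j"
      unfolding j(2) funpow_cycle_of_list_nth[OF assms(1) j(1)]
      using j(1) by (intro nth_eq_iff_index_eq[OF assms(1)]) (auto intro: mod_less_divisor)
    also have "\<dots> \<longleftrightarrow> (j + k) mod length cs = (j + 0) mod length cs"
      using j(1) by simp
    also have "\<dots> \<longleftrightarrow> length cs dvd k"
      using nat_mod_eq_iff[of "j + k" "length cs" "j + 0"]
      by (metis add_diff_cancel_left' le_add1 mod_eq_dvd_iff_nat add_0_right)
    finally show ?thesis .
  qed
  then show ?thesis
    using least_power_dvd[OF permutation_of_cycle[of cs], of i]
    by (metis dvd_antisym dvd_refl)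
qed

lemma cycle_of_list_image: "cycle_of_list cs i \<in> set cs \<longleftrightarrow> i \<in> set cs"
  by (simp add: cycle_permutes permutes_in_image)

text \<open>Since \<open>y\<close> fixes the points of \<open>cs\<close>, the orbit of such a point
  under the product never leaves \<open>cs\<close> and never feels \<open>y\<close>. This and its
  counterpart off \<open>cs\<close> let cycle lengths be read off from the two factors.\<close>

lemma funpow_cycle_comp_in:
  assumes "y permutes T" "T \<inter> set cs = {}" "i \<in> set cs"
  shows "((cycle_of_list cs \<circ> y) ^^ k) i = (cycle_of_list cs ^^ k) i"
proof -
  have in_cs: "(cycle_of_list cs ^^ k) i \<in> set cs" for k
    by (induction k) (use assms(3) in \<open>auto simp: cycle_of_list_image\<close>)
  show ?thesis
  proof (induction k)
    case (Suc k)
    have "y ((cycle_of_list cs ^^ k) i) = (cycle_of_list cs ^^ k) i"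
      using in_cs[of k] assms(1,2) by (meson disjoint_iff permutes_not_in)
    then show ?case using Suc by simp
  qed simp
qed

lemma funpow_cycle_comp_notin:
  assumes "y permutes T" "T \<inter> set cs = {}" "i \<notin> set cs"
  shows "((cycle_of_list cs \<circ> y) ^^ k) i = (y ^^ k) i"
proof -
  have "y permutes (- set cs)"
    using assms(1,2) permutes_subset by blast
  then have notin: "(y ^^ k) i \<notin> set cs" for k
    by (metis ComplD ComplI assms(3) permutes_funpow permutes_in_image)
  show ?thesis
  proof (induction k)
    case (Suc k)
    then show ?case using notin[of "Suc k"] by (simp add: id_outside_supp)
  qed simp
qed

lemma least_power_cong:
  assumes "\<And>k. (f ^^ k) i = (g ^^ k) i"
  shows "least_power f i = least_power g i"
  unfolding least_power_def assms ..

lemma least_power_cycle_comp_in: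
  assumes "y permutes T" "T \<inter> set cs = {}" "i \<in> set cs" "distinct cs"
  shows "least_power (cycle_of_list cs \<circ> y) i = length cs"
  using least_power_cong[OF funpow_cycle_comp_in[OF assms(1-3)]] assms(3,4)
  by (simp add: least_power_cycle_of_list)

lemma least_power_cycle_comp_notin:
  assumes "y permutes T" "T \<inter> set cs = {}" "i \<notin> set cs"
  shows "least_power (cycle_of_list cs \<circ> y) i = least_power y i"
  by (rule least_power_cong[OF funpow_cycle_comp_notin[OF assms]])

subsection \<open>Counting permutations of given sign\<close>

text \<open>With the sign as a parameter, even and odd permutations are counted by the same lemmas,
  and the sign of an extracted cycle can be moved into the parameter.\<close>

definition signed_perms :: "int \<Rightarrow> 'a set \<Rightarrow> ('a \<Rightarrow> 'a) set"
  where "signed_perms s S = {p. p permutes S \<and> sign p = s}"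

text \<open>A list represents a cycle with a marked starting point, so an \<open>l\<close>-cycle has
  \<open>l\<close> representatives. Counting pointed cycles avoids a quotient by rotation.\<close>

definition distinct_lists :: "nat \<Rightarrow> 'a set \<Rightarrow> 'a list set"
  where "distinct_lists l S = {cs. length cs = l \<and> distinct cs \<and> set cs \<subseteq> S}"

lemma finite_signed_perms [simp]: "finite S \<Longrightarrow> finite (signed_perms s S)"
  unfolding signed_perms_def by (rule finite_subset[OF _ finite_permutations]) auto

lemma finite_distinct_lists [simp]: "finite S \<Longrightarrow> finite (distinct_lists l S)"
  unfolding distinct_lists_def
  by (rule finite_subset[OF _ finite_lists_length_eq[of S l]]) auto

text \<open>The product form of the falling factorial is chosen because
  \<open>fact (card S - l)\<close> also counts the permutations of the points outside the
  list.\<close>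

lemma card_distinct_lists:
  assumes "finite S" "l \<le> card S"
  shows "card (distinct_lists l S) * fact (card S - l) = fact (card S)"
proof -
  have "card (distinct_lists l S) = \<Prod>{card S - l + 1 .. card S}"
    unfolding distinct_lists_def using card_lists_distinct_length_eq[OF assms] .
  also have "\<dots> * fact (card S - l) = \<Prod>{1..card S}"
  proof -
    have "{1..card S} = {1..card S - l} \<union> {card S - l + 1 .. card S}"
      using assms(2) by auto
    then show ?thesis
      by (simp add: prod.union_disjoint fact_prod mult.commute)
  qed
  finally show ?thesis by (simp add: fact_prod)
qed

lemma cycle_comp_signed_perms:
  assumes "finite S" "cs \<in> distinct_lists l S" "l > 0"
    and "y \<in> signed_perms (s * (-1) ^ (l - 1)) (S - set cs)"
  shows "cycle_of_list cs \<circ> y \<in> signed_perms s S"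
proof -
  have cs: "length cs = l" "distinct cs" "set cs \<subseteq> S" "cs \<noteq> []"
    using assms(2,3) by (auto simp: distinct_lists_def)
  have y: "y permutes (S - set cs)" "sign y = s * (-1) ^ (l - 1)"
    using assms(4) by (auto simp: signed_perms_def)
  have "cycle_of_list cs \<circ> y permutes S"
    using y(1) cs(3) by (meson permutes_compose permutes_subset cycle_permutes Diff_subset)
  moreover have "permutation y"
    using y(1) assms(1) permutation_permutes by blast
  ultimately show ?thesis
    by (simp add: signed_perms_def sign_compose permutation_of_cycle sign_cycle_of_list
          cs y(2) power_mult_distrib[symmetric] mult.left_commute[of _ s])
qed

text \<open>Iterating the product from the recorded head runs through the list, so head and product
  determine \<open>cs\<close>; cancelling the cycle then determines \<open>y\<close>.\<close>

lemma inj_on_cycle_comp: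
  "inj_on (\<lambda>(cs, y). (hd cs, cycle_of_list cs \<circ> y))
     (SIGMA cs:distinct_lists l S. signed_perms t (S - set cs))" if "l > 0"
proof (rule inj_onI, clarify)
  fix cs y cs' y'
  assume cs: "cs \<in> distinct_lists l S" "cs' \<in> distinct_lists l S"
    and y: "y \<in> signed_perms t (S - set cs)" "y' \<in> signed_perms t (S - set cs')"
    and hd: "hd cs = hd cs'" and eq: "cycle_of_list cs \<circ> y = cycle_of_list cs' \<circ> y'"
  have nth: "cs ! i = ((cycle_of_list cs \<circ> y) ^^ i) (hd cs)"
    if "cs \<in> distinct_lists l S" "y \<in> signed_perms t (S - set cs)" "i < l" for cs y i
  proof -
    have *: "length cs = l" "distinct cs" using that by (auto simp: distinct_lists_def)
    with that(3) have hd: "hd cs = cs ! 0" "hd cs \<in> set cs"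
      by (cases cs; force)+
    have "((cycle_of_list cs \<circ> y) ^^ i) (hd cs) = (cycle_of_list cs ^^ i) (hd cs)"
      using that(2) hd(2) by (intro funpow_cycle_comp_in) (auto simp: signed_perms_def)
    then show ?thesis
      unfolding hd(1) using * that(3) by (simp add: funpow_cycle_of_list_nth)
  qed
  have "cs = cs'"
    using nth[OF cs(1) y(1)] nth[OF cs(2) y(2)] cs eq hd
    by (intro nth_equalityI) (auto simp: distinct_lists_def)
  then show "cs = cs' \<and> y = y'"
    using eq by (metis bij_is_inj cycle_permutes fun.inj_map_strong inj_eq permutes_bij ext comp_apply)
qed

lemma least_power_le_card:
  assumes "x permutes S" "finite S" "i \<in> S"
  shows "least_power x i \<le> card S"
proof -
  have px: "permutation x" using assms permutation_permutes by blast
  have "set (support x i) \<subseteq> S"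
    using permutes_in_image[OF permutes_funpow[OF assms(1)]] assms(3) by auto
  then show ?thesis
    using card_mono[OF assms(2), of "set (support x i)"] distinct_card[OF cycle_of_permutation[OF px, of i]]
    by (simp del: set_map)
qed

lemma least_power_funpow:
  assumes "permutation x"
  shows "least_power x ((x ^^ j) i) = least_power x i"
proof -
  have inj: "inj (x ^^ j)"
    using assms by (simp add: bij_is_inj inj_fn permutation)
  have "(x ^^ k) ((x ^^ j) i) = (x ^^ j) i \<longleftrightarrow> (x ^^ k) i = i" for k
  proof -
    have "(x ^^ k) ((x ^^ j) i) = (x ^^ j) ((x ^^ k) i)"
      by (metis add.commute funpow_add comp_apply)
    then show ?thesis using inj by (simp add: inj_eq)
  qed
  then show ?thesis unfolding least_power_def by simp
qed

text \<open>Converse of the gluing: list the orbit of \<open>i\<close> from \<open>i\<close> on as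
  \<open>cs\<close>, and let \<open>y\<close> be \<open>x\<close> off this orbit and the identity on
  it.\<close>

lemma ex_cycle_comp:
  assumes "finite S" "x \<in> signed_perms s S" "i \<in> S" "least_power x i = l"
  shows "(i, x) \<in> (\<lambda>(cs, y). (hd cs, cycle_of_list cs \<circ> y)) `
     (SIGMA cs:distinct_lists l S. signed_perms (s * (-1) ^ (l - 1)) (S - set cs))"
proof -
  have x: "x permutes S" "sign x = s" using assms(2) by (auto simp: signed_perms_def)
  have px: "permutation x" using x assms(1) permutation_permutes by blast
  define cs where "cs = support x i"
  define y where "y = (\<lambda>j. if j \<in> S - set cs then x j else j)"
  have lpos: "l > 0" using least_power_of_permutation(2)[OF px] assms(4) by auto
  have dist: "distinct cs" unfolding cs_def by (rule cycle_of_permutation[OF px])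
  have len: "length cs = l" unfolding cs_def using assms(4) by simp
  have sub: "set cs \<subseteq> S"
    unfolding cs_def using permutes_in_image[OF permutes_funpow[OF x(1)]] assms(3) by auto
  have hd: "hd cs = i" unfolding cs_def using lpos assms(4) by (simp add: hd_map)
  have y: "y permutes (S - set cs)"
    unfolding y_def cs_def by (rule semidecomposition[OF x(1) assms(1)])
  have py: "permutation y" using y assms(1) permutation_permutes by blast
  have eq: "cycle_of_list cs \<circ> y = x"
  proof
    fix a
    consider "a \<in> S - set cs" | "a \<in> set cs" | "a \<notin> S" by blast
    then show "(cycle_of_list cs \<circ> y) a = x a"
    proof cases
      case 1
      then have "y a \<in> S - set cs" using y permutes_in_image by metis
      then show ?thesis using 1 by (auto simp: id_outside_supp y_def)
    next
      case 2
      then show ?thesis using cycle_restrict[OF px, of a i] by (simp add: y_def cs_def)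
    next
      case 3
      then have "a \<notin> set cs" using sub by auto
      with 3 show ?thesis using x(1) by (simp add: y_def id_outside_supp permutes_not_in)
    qed
  qed
  have "s = (-1) ^ (l - 1) * sign y"
    using sign_compose[OF permutation_of_cycle[of cs] py] eq x(2) dist len lpos
    by (auto simp: sign_cycle_of_list)
  then have "sign y = s * (-1) ^ (l - 1)"
    by (simp add: power_mult_distrib[symmetric])
  with y have "y \<in> signed_perms (s * (-1) ^ (l - 1)) (S - set cs)"
    by (simp add: signed_perms_def)
  then show ?thesis
    using dist len sub hd eq by (force simp: distinct_lists_def)
qed

section \<open>Sizes of the sign classes and frequency of a given cycle length\<close>

lemma card_signed_perms:
  assumes "finite S" "card S \<ge> 2" "s \<in> {1, -1}"
  shows "2 * card (signed_perms s S) = fact (card S)"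
proof -
  obtain a b where ab: "a \<in> S" "b \<in> S" "a \<noteq> b"
    using assms(2) by (metis card_2_iff' obtain_subset_with_card_n subsetD)
  have perm: "permutation p" if "p permutes S" for p
    using that assms(1) permutation_permutes by blast
  \<comment> \<open>Composition with a fixed transposition is an involution exchanging the two
    signs, so each class is half of all permutations.\<close>
  have flip: "Transposition.transpose a b \<circ> p \<in> signed_perms (- t) S" if "p \<in> signed_perms t S" for p t
    using that ab permutes_compose[OF _ permutes_swap_id[of a S b], of p] perm[of p]
    by (auto simp: signed_perms_def sign_compose permutation_swap_id sign_swap_id)
  have "bij_betw (\<lambda>p. Transposition.transpose a b \<circ> p) (signed_perms s S) (signed_perms (- s) S)"
  proof (rule bij_betw_byWitness[where f' = "\<lambda>p. Transposition.transpose a b \<circ> p"])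
    show "(\<circ>) (Transposition.transpose a b) ` signed_perms (- s) S \<subseteq> signed_perms s S"
      using flip[of _ "- s"] by auto
  qed (use flip in \<open>auto simp: fun_eq_iff\<close>)
  then have "card (signed_perms s S) = card (signed_perms (- s) S)"
    by (rule bij_betw_same_card)
  moreover have "signed_perms s S \<union> signed_perms (- s) S = {p. p permutes S}"
  proof -
    have "sign p = s \<or> sign p = - s" for p :: "'a \<Rightarrow> 'a"
      using assms(3) by (cases p rule: sign_cases) auto
    then show ?thesis by (auto simp: signed_perms_def)
  qed
  moreover have "signed_perms s S \<inter> signed_perms (- s) S = {}"
    using assms(3) by (auto simp: signed_perms_def)
  ultimately show ?thesis
    using card_Un_disjoint[of "signed_perms s S" "signed_perms (- s) S"] assms(1)
      card_permutations[OF refl assms(1)] by simp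
qed

text \<open>On at most one point the identity is the only permutation, so a sign class can be
  everything instead of half. The factor 2 absorbs this case.\<close>

lemma card_signed_perms_le:
  assumes "finite S" "s \<in> {1, -1}"
  shows "2 * card (signed_perms s S) \<le> (if card S \<le> 1 then 2 else 1) * fact (card S)"
proof (cases "card S \<le> 1")
  case True
  have "card (signed_perms s S) \<le> card {p. p permutes S}"
    by (rule card_mono) (auto simp: signed_perms_def finite_permutations assms(1))
  then show ?thesis using True card_permutations[OF refl assms(1)] by simp
qed (use card_signed_perms[OF assms(1) _ assms(2)] in simp)

text \<open>Double counting of pairs of a permutation and a point on one of its
  \<open>l\<close>-cycles: each permutation concerned has at least \<open>l\<close> such points,
  while each pair arises from a pointed cycle and a permutation of the other points. Relative to
  half of the factorial this is the proportion 1/l, or 2/l if at most one point remains.\<close>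

lemma card_signed_perms_cycle_length:
  assumes "finite S" "s \<in> {1, -1}" "l > 0" "l \<le> card S"
  shows "2 * l * card {x \<in> signed_perms s S. \<exists>i\<in>S. least_power x i = l}
    \<le> (if card S - l \<le> 1 then 2 else 1) * fact (card S)"
proof -
  let ?bad = "{x \<in> signed_perms s S. \<exists>i\<in>S. least_power x i = l}"
  let ?t = "s * (-1) ^ (l - 1)"
  let ?Z = "SIGMA cs:distinct_lists l S. signed_perms ?t (S - set cs)"
  let ?c = "if card S - l \<le> 1 then 2 else 1 :: nat"
  define T where "T = (SIGMA x:?bad. {i \<in> S. least_power x i = l})"
  have fin: "finite ?bad" using assms(1) by simp
  have finZ: "finite ?Z" using assms(1) by auto
  have orbit: "l \<le> card {i \<in> S. least_power x i = l}" if "x \<in> ?bad" for x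
  proof -
    from that obtain i where i: "i \<in> S" "least_power x i = l" and x: "x permutes S"
      by (auto simp: signed_perms_def)
    have px: "permutation x" using x assms(1) permutation_permutes by blast
    have "set (support x i) \<subseteq> {i \<in> S. least_power x i = l}"
      using i least_power_funpow[OF px] permutes_in_image[OF permutes_funpow[OF x]] by auto
    from card_mono[OF _ this] show ?thesis
      using assms(1) distinct_card[OF cycle_of_permutation[OF px, of i]] i(2)
      by (simp del: set_map)
  qed
  have "l * card ?bad = (\<Sum>x\<in>?bad. l)" by simp
  also have "\<dots> \<le> (\<Sum>x\<in>?bad. card {i \<in> S. least_power x i = l})"
    using orbit by (rule sum_mono)
  also have "\<dots> = card T"
    unfolding T_def using fin assms(1) by simp
  also have "\<dots> = card (prod.swap ` T)"
    by (simp add: card_image)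
  also have "\<dots> \<le> card ((\<lambda>(cs, y). (hd cs, cycle_of_list cs \<circ> y)) ` ?Z)"
  proof (rule card_mono)
    show "prod.swap ` T \<subseteq> (\<lambda>(cs, y). (hd cs, cycle_of_list cs \<circ> y)) ` ?Z"
      unfolding T_def using ex_cycle_comp[OF assms(1), of _ s _ l] by auto
  qed (use finZ in simp)
  also have "\<dots> \<le> card ?Z" by (rule card_image_le[OF finZ])
  also have "\<dots> = (\<Sum>cs\<in>distinct_lists l S. card (signed_perms ?t (S - set cs)))"
    using assms(1) by simp
  finally have le: "l * card ?bad \<le> (\<Sum>cs\<in>distinct_lists l S. card (signed_perms ?t (S - set cs)))" .
  have "2 * l * card ?bad \<le> (\<Sum>cs\<in>distinct_lists l S. 2 * card (signed_perms ?t (S - set cs)))"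
    using le by (simp add: sum_distrib_left[symmetric])
  also have "\<dots> \<le> (\<Sum>cs\<in>distinct_lists l S. ?c * fact (card S - l))"
  proof (rule sum_mono)
    fix cs assume "cs \<in> distinct_lists l S"
    then have "card (S - set cs) = card S - l"
      using assms(1) by (auto simp: distinct_lists_def card_Diff_subset distinct_card)
    moreover have "?t \<in> {1, -1}"
      using assms(2) by (auto simp: minus_one_power_iff)
    ultimately show "2 * card (signed_perms ?t (S - set cs)) \<le> ?c * fact (card S - l)"
      using card_signed_perms_le[of "S - set cs" ?t] assms(1) by simp
  qed
  also have "\<dots> = ?c * (card (distinct_lists l S) * fact (card S - l))"
    by simp
  also have "card (distinct_lists l S) * fact (card S - l) = fact (card S)"
    by (rule card_distinct_lists[OF assms(1,4)])
  finally show ?thesis .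
qed

section \<open>Permutations with no cycle length divisible by m, or with exactly one\<close>

definition perms_without_cycle_dvd :: "nat \<Rightarrow> int \<Rightarrow> 'a set \<Rightarrow> ('a \<Rightarrow> 'a) set"
  where "perms_without_cycle_dvd m s S = {y \<in> signed_perms s S. \<forall>i\<in>S. \<not> m dvd least_power y i}"

text \<open>Union bound over the cycle lengths \<open>j * m\<close> with \<open>j\<close> up to
  \<open>card S div m\<close>. The terms 1/(j m) add up to \<open>harm\<close> divided by
  \<open>m\<close>; the exceptional factor 2 costs at most one further 1/m.\<close>

lemma card_perms_without_cycle_dvd_ge:
  assumes "finite S" "s \<in> {1, -1}" "m \<ge> 2" "card S \<ge> 2"
  shows "fact (card S) / 2 * (1 - (1 + harm (card S div m)) / m) \<le> real (card (perms_without_cycle_dvd m s S))"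
proof -
  define N where "N = card S"
  define q where "q = N div m"
  define bad where "bad l = {x \<in> signed_perms s S. \<exists>i\<in>S. least_power x i = l}" for l
  have fin: "finite (bad l)" for l unfolding bad_def using assms(1) by simp
  have cover: "signed_perms s S \<subseteq> perms_without_cycle_dvd m s S \<union> (\<Union>j\<in>{1..q}. bad (j * m))"
  proof
    fix x assume x: "x \<in> signed_perms s S"
    show "x \<in> perms_without_cycle_dvd m s S \<union> (\<Union>j\<in>{1..q}. bad (j * m))"
    proof (cases "x \<in> perms_without_cycle_dvd m s S")
      case False
      then obtain i where i: "i \<in> S" "m dvd least_power x i"
        using x by (auto simp: perms_without_cycle_dvd_def)
      have xp: "x permutes S" using x by (simp add: signed_perms_def)
      then have px: "permutation x" using assms(1) permutation_permutes by blast
      obtain j where j: "least_power x i = j * m" using i(2) by (metis dvd_def mult.commute)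
      have "j * m > 0" using least_power_of_permutation(2)[OF px, of i] j by simp
      moreover have "j * m \<le> N"
        using least_power_le_card[OF xp assms(1) i(1)] j by (simp add: N_def)
      ultimately have "j \<in> {1..q}"
        using assms(3) by (auto simp: q_def less_eq_div_iff_mult_less_eq)
      then show ?thesis using x i(1) j by (auto simp: bad_def)
    qed simp
  qed
  have bad_le: "real (card (bad (j * m))) \<le> fact N / 2 * (inverse (real j) / m + (if j = q then 1 / m else 0))"
    if j: "j \<in> {1..q}" for j
  proof -
    have jm: "j * m > 0" "j * m \<le> N"
      using j assms(3) by (auto simp: q_def less_eq_div_iff_mult_less_eq)
    define c :: nat where "c = (if j = q then 2 else 1)"
    \<comment> \<open>For \<open>j < q\<close> another block of \<open>m >= 2\<close> points still
      fits, so the factor 2 can occur only at the last multiple.\<close>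
    have "j = q" if "N - j * m \<le> 1"
    proof (rule ccontr)
      assume "j \<noteq> q"
      then have "Suc j \<le> q" using j by simp
      then have "Suc j * m \<le> N" using assms(3) by (simp add: q_def less_eq_div_iff_mult_less_eq)
      then show False using that assms(3) by simp
    qed
    then have c_ge: "(if N - j * m \<le> 1 then 2 else 1) \<le> c"
      by (cases "N - j * m \<le> 1") (simp_all add: c_def)
    have "2 * (j * m) * card (bad (j * m)) \<le> (if N - j * m \<le> 1 then 2 else 1) * fact N"
      using card_signed_perms_cycle_length[OF assms(1,2) jm(1)] jm(2)
      unfolding bad_def N_def by blast
    also have "\<dots> \<le> c * fact N"
      using c_ge by (rule mult_right_mono) simp
    finally have "real (2 * (j * m) * card (bad (j * m))) \<le> real (c * fact N)"
      by (rule of_nat_mono)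
    then have "real (card (bad (j * m))) \<le> fact N / 2 * (real c / (real j * m))"
      using j assms(3) by (simp add: field_simps)
    also have "\<dots> \<le> fact N / 2 * (inverse (real j) / m + (if j = q then 1 / m else 0))"
    proof (rule mult_left_mono)
      \<comment> \<open>This bounds the second copy of 1/(j m) at \<open>j = q\<close> and is the
        source of the 1 in \<open>1 + harm\<close>.\<close>
      have le: "1 / (real j * m) \<le> 1 / m"
        using j assms(3) by (simp add: divide_simps)
      have eq: "inverse (real j) / m = 1 / (real j * m)"
        by (simp add: field_simps)
      show "real c / (real j * m) \<le> inverse (real j) / m + (if j = q then 1 / m else 0)"
      proof (cases "j = q")
        case True
        then have "real c / (real j * m) = 1 / (real j * m) + 1 / (real j * m)"
          by (simp add: c_def)
        with le show ?thesis unfolding eq if_P[OF True] by linarith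
      next
        case False
        then show ?thesis unfolding eq by (simp add: c_def)
      qed
    qed simp
    finally show ?thesis .
  qed
  have "fact N / 2 = real (card (signed_perms s S))"
    using card_signed_perms[OF assms(1,4,2)] unfolding N_def
    by (metis of_nat_fact of_nat_mult of_nat_numeral nonzero_mult_div_cancel_left zero_neq_numeral)
  also have "\<dots> \<le> real (card (perms_without_cycle_dvd m s S \<union> (\<Union>j\<in>{1..q}. bad (j * m))))"
    using cover by (intro of_nat_mono card_mono) (auto simp: fin perms_without_cycle_dvd_def assms(1))
  also have "\<dots> \<le> real (card (perms_without_cycle_dvd m s S) + (\<Sum>j\<in>{1..q}. card (bad (j * m))))"
    by (intro of_nat_mono order_trans[OF card_Un_le] add_left_mono card_UN_le) simp
  also have "\<dots> \<le> real (card (perms_without_cycle_dvd m s S))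
      + (\<Sum>j\<in>{1..q}. fact N / 2 * (inverse (real j) / m + (if j = q then 1 / m else 0)))"
    unfolding of_nat_add of_nat_sum by (intro add_left_mono sum_mono bad_le)
  also have "(\<Sum>j\<in>{1..q}. fact N / 2 * (inverse (real j) / m + (if j = q then 1 / m else 0)))
      = fact N / 2 * (harm q / m + (\<Sum>j\<in>{1..q}. if j = q then 1 / m else 0))"
    by (simp only: sum_distrib_left[symmetric] sum.distrib harm_def sum_divide_distrib)
  also have "\<dots> \<le> fact N / 2 * (harm q / m + 1 / m)"
    by (intro mult_left_mono add_left_mono) auto
  finally show ?thesis
    unfolding N_def[symmetric] q_def[symmetric] by (simp add: algebra_simps add_divide_distrib)
qed

text \<open>For \<open>m > 0\<close> the set \<open>A\<close> is the set of points on
  \<open>m\<close>-cycles and has only \<open>m\<close> elements, hence it is a single cycle. The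
  description by least powers avoids a separate notion of cycle decomposition.\<close>

definition one_cycle_perms :: "nat \<Rightarrow> int \<Rightarrow> 'a set \<Rightarrow> ('a \<Rightarrow> 'a) set"
  where "one_cycle_perms m s S = {x \<in> signed_perms s S.
    \<exists>A\<subseteq>S. card A = m \<and> (\<forall>i\<in>A. least_power x i = m) \<and> (\<forall>i\<in>S - A. \<not> m dvd least_power x i)}"

text \<open>Gluing a pointed \<open>m\<close>-cycle to a permutation of the other points without
  cycle lengths divisible by \<open>m\<close> is injective once the head is recorded. A given result
  admits at most \<open>m\<close> heads, whence the division by \<open>m\<close>.\<close>

lemma card_one_cycle_perms_ge:
  assumes "finite S" "s \<in> {1, -1}" "m \<ge> 2" "m + 2 \<le> card S"
  shows "fact (card S) / (2 * m) * (1 - (1 + harm ((card S - m) div m)) / m)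
    \<le> real (card (one_cycle_perms m s S))"
proof -
  let ?t = "s * (-1) ^ (m - 1)"
  let ?Z = "SIGMA cs:distinct_lists m S. perms_without_cycle_dvd m ?t (S - set cs)"
  let ?T = "SIGMA x:one_cycle_perms m s S. {i \<in> S. least_power x i = m}"
  let ?f = "\<lambda>(cs, y). (hd cs, cycle_of_list cs \<circ> y)"
  let ?r = "1 - (1 + harm ((card S - m) div m)) / m :: real"
  have fin: "finite (one_cycle_perms m s S)"
    unfolding one_cycle_perms_def using assms(1) by simp
  have t: "?t \<in> {1, -1}"
    using assms(2) by (auto simp: minus_one_power_iff)
  have img: "?f ` ?Z \<subseteq> prod.swap ` ?T"
  proof clarify
    fix cs y assume cs: "cs \<in> distinct_lists m S" and y: "y \<in> perms_without_cycle_dvd m ?t (S - set cs)"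
    let ?x = "cycle_of_list cs \<circ> y"
    have cs': "length cs = m" "distinct cs" "set cs \<subseteq> S" "hd cs \<in> set cs"
      using cs assms(3) by (auto simp: distinct_lists_def intro!: hd_in_set)
    have y': "y \<in> signed_perms ?t (S - set cs)" "y permutes (S - set cs)"
      using y by (auto simp: perms_without_cycle_dvd_def signed_perms_def)
    have x: "?x \<in> signed_perms s S"
      using cycle_comp_signed_perms[OF assms(1) cs _ y'(1)] assms(3) by simp
    have lp: "least_power ?x i = m" if "i \<in> set cs" for i
      using least_power_cycle_comp_in[OF y'(2) _ that cs'(2)] cs'(1) by auto
    have ndvd: "\<not> m dvd least_power ?x i" if "i \<in> S - set cs" for i
    proof -
      have "least_power ?x i = least_power y i"
        using least_power_cycle_comp_notin[OF y'(2), of cs i] that by blast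
      then show ?thesis using that y by (simp add: perms_without_cycle_dvd_def)
    qed
    have "?x \<in> one_cycle_perms m s S"
      unfolding one_cycle_perms_def using x lp ndvd cs' distinct_card[OF cs'(2)]
      by (intro CollectI conjI exI[of _ "set cs"]) auto
    then show "(hd cs, ?x) \<in> prod.swap ` ?T"
      using lp cs' by (force intro: image_eqI[of _ _ "(?x, hd cs)"])
  qed
  have inj: "inj_on ?f ?Z"
    by (rule inj_on_subset[OF inj_on_cycle_comp[of m S ?t]]) (use assms(3) in \<open>auto simp: perms_without_cycle_dvd_def\<close>)
  have fibre: "card {i \<in> S. least_power x i = m} \<le> m" if "x \<in> one_cycle_perms m s S" for x
  proof -
    from that obtain A where A: "A \<subseteq> S" "card A = m" "\<forall>i\<in>S - A. \<not> m dvd least_power x i"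
      by (auto simp: one_cycle_perms_def)
    have "{i \<in> S. least_power x i = m} \<subseteq> A"
    proof (intro subsetI, rule ccontr)
      fix i assume i: "i \<in> {i \<in> S. least_power x i = m}" "i \<notin> A"
      with A(3) have "\<not> m dvd least_power x i" by blast
      with i(1) show False by simp
    qed
    from card_mono[OF finite_subset[OF A(1) assms(1)] this] show ?thesis using A(2) by simp
  qed
  have "card ?Z \<le> card (prod.swap ` ?T)"
    using card_mono[OF _ img] card_image[OF inj] fin assms(1) by simp
  also have "\<dots> = (\<Sum>x\<in>one_cycle_perms m s S. card {i \<in> S. least_power x i = m})"
    using fin assms(1) by (simp add: card_image)
  also have "\<dots> \<le> (\<Sum>x\<in>one_cycle_perms m s S. m)"
    using fibre by (rule sum_mono)
  finally have Z_le: "card ?Z \<le> m * card (one_cycle_perms m s S)" by (simp add: mult.commute)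
  have "fact (card S) / 2 * ?r
      = real (card (distinct_lists m S) * fact (card S - m)) / 2 * ?r"
    using assms(4) by (subst card_distinct_lists[OF assms(1)]) auto
  also have "\<dots> = (\<Sum>cs\<in>distinct_lists m S. fact (card S - m) / 2 * ?r)"
    by simp
  also have "\<dots> \<le> (\<Sum>cs\<in>distinct_lists m S. real (card (perms_without_cycle_dvd m ?t (S - set cs))))"
  proof (rule sum_mono)
    fix cs assume "cs \<in> distinct_lists m S"
    then have "card (S - set cs) = card S - m"
      using assms(1) by (auto simp: distinct_lists_def card_Diff_subset distinct_card)
    then show "fact (card S - m) / 2 * ?r \<le> real (card (perms_without_cycle_dvd m ?t (S - set cs)))"
      using card_perms_without_cycle_dvd_ge[of "S - set cs" ?t m] assms t by simp
  qed
  also have "\<dots> = real (card ?Z)"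
    using assms(1) by (simp add: perms_without_cycle_dvd_def)
  also have "\<dots> \<le> real m * real (card (one_cycle_perms m s S))"
    using Z_le by (metis of_nat_le_iff of_nat_mult)
  finally show ?thesis
    using assms(3) by (simp add: field_simps)
qed

subsection \<open>The choice of the cycle length\<close>

lemma ln_ge_of_power2_le:
  assumes "2 ^ j \<le> n"
  shows "2 * real j / 3 \<le> ln (real n)"
proof -
  have "2 * real j / 3 \<le> real j * ln 2"
    using mult_left_mono[OF ln2_ge_two_thirds, of "real j"] by simp
  also have "\<dots> = ln (2 ^ j)" by (simp add: ln_realpow)
  also have "\<dots> \<le> ln (real n)"
    using assms by (subst ln_le_cancel_iff)
      (auto simp flip: of_nat_power_le_of_nat_cancel_iff simp: order_less_le_trans[of 0 "2 ^ j" n])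
  finally show ?thesis .
qed

text \<open>The difference \<open>harm q - ln q\<close> decreases in \<open>q\<close> and equals 1
  at \<open>q = 1\<close>.\<close>

lemma harm_le_Suc_ln:
  assumes "q > 0"
  shows "harm q \<le> 1 + ln (real q)"
  using euler_mascheroni_sequence_decreasing[of 1 q] assms by (simp add: harm_expand)

text \<open>Here the cycle length is 4. Bounding the harmonic number from above and
  \<open>ln n\<close> from below by a power of two leaves finitely many rational
  inequalities.\<close>

lemma main_term_ge_small:
  fixes n :: nat
  assumes "9 \<le> n" "n < 36"
  shows "inverse (13 * ln (real n)) \<le> (1 - (1 + harm ((n - 4) div 4)) / 4) / 4"
proof -
  define q where "q = (n - 4) div 4"
  have bound: "inverse (13 * ln (real n)) \<le> (1 - (1 + harm q) / 4) / 4"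
    if "q \<le> r" "2 ^ j \<le> n" "j > 0" "3 / (26 * real j) \<le> (1 - (1 + harm r) / 4) / 4" for r j
  proof -
    have "inverse (13 * ln (real n)) \<le> inverse (13 * (2 * real j / 3))"
      using ln_ge_of_power2_le[OF that(2)] that(3) by (intro le_imp_inverse_le mult_left_mono) auto
    also have "\<dots> = 3 / (26 * real j)" by (simp add: field_simps)
    also note that(4)
    also have "(1 - (1 + harm r) / 4) / 4 \<le> (1 - (1 + harm q) / 4 :: real) / 4"
      using harm_mono[OF that(1), where 'a = real] by simp
    finally show ?thesis .
  qed
  \<comment> \<open>The three cases cover \<open>n\<close> up to 23, from 16 to 31, and from 32
    on.\<close>
  consider "q \<le> 4" "2 ^ 3 \<le> n" | "q \<le> 6" "2 ^ 4 \<le> n" | "q \<le> 7" "2 ^ 5 \<le> n"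
    using assms unfolding q_def by fastforce
  then show ?thesis
    unfolding q_def[symmetric]
    by cases (rule bound, assumption, assumption, simp, simp add: harm_expand)+
qed

lemma main_term_ge_large:
  fixes n :: nat
  assumes "36 \<le> n"
  obtains k where "k > 0" "real (2 ^ k) \<le> 4 * sqrt n / 3" "2 ^ k + 2 \<le> n"
    "inverse (13 * ln (real n)) \<le> (1 - (1 + harm ((n - 2 ^ k) div 2 ^ k)) / 2 ^ k) / 2 ^ k"
proof -
  define b where "b = min (4 * sqrt n / 3) (4 * ln n)"
  have sqrt6: "6 \<le> sqrt n" using assms by (intro real_le_rsqrt) simp
  have "2 \<le> ln (real n)" using ln_ge_of_power2_le[of 3 n] assms by simp
  \<comment> \<open>The threshold 36 is where \<open>4 * sqrt n / 3\<close> reaches 8;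
    \<open>4 * ln n\<close> exceeds 8 by then.\<close>
  with sqrt6 have b8: "8 \<le> b" by (simp add: b_def)
  obtain k where k: "2 ^ k \<le> nat \<lfloor>b\<rfloor>" "nat \<lfloor>b\<rfloor> < 2 ^ (k + 1)"
    using ex_power_ivl1[of 2 "nat \<lfloor>b\<rfloor>"] b8 by (auto simp: le_nat_floor le_nat_iff le_floor_iff)
  define m :: nat where "m = 2 ^ k"
  have mb: "real m \<le> b" "b < 2 * real m"
  proof -
    have "real m \<le> real (nat \<lfloor>b\<rfloor>)" using k(1) unfolding m_def of_nat_le_iff .
    also have "\<dots> \<le> b" using b8 by simp
    finally show "real m \<le> b" .
    have "Suc (nat \<lfloor>b\<rfloor>) \<le> 2 * m" using k(2) unfolding m_def by simp
    then have "real (nat \<lfloor>b\<rfloor>) + 1 \<le> 2 * real m"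
      by (metis of_nat_Suc of_nat_le_iff of_nat_mult of_nat_numeral add.commute)
    then show "b < 2 * real m" using b8 by linarith
  qed
  \<comment> \<open>From \<open>8 <= b < 2 * m\<close> follows \<open>m > 4\<close>, and a power of
    two above 4 is at least 8.\<close>
  have "(2::nat) ^ 2 < 2 ^ k" using mb b8 by (simp add: m_def flip: of_nat_less_iff[where 'a = real])
  then have k3: "3 \<le> k" by (subst (asm) power_strict_increasing_iff) auto
  then have m8: "8 \<le> m" using power_increasing[of 3 k "2::nat"] by (simp add: m_def)
  have m_le: "real m \<le> 4 * sqrt n / 3" "real m \<le> 4 * ln n" using mb(1) by (auto simp: b_def)
  have n_sq: "real n = sqrt n * sqrt n" by simp
  have "6 * sqrt n \<le> real n" using sqrt6 n_sq by (metis mult_right_mono real_sqrt_ge_zero of_nat_0_le_iff)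
  then have "2 * real m \<le> real n" using m_le(1) sqrt6 by linarith
  then have n2m: "2 * m \<le> n" by (metis of_nat_le_iff of_nat_mult of_nat_numeral)
  define q where "q = (n - m) div m"
  have q: "q > 0" unfolding q_def using n2m m8 by (simp add: div_greater_zero_iff)
  have "q * m \<le> n" unfolding q_def by (meson diff_le_self div_times_less_eq_dividend le_trans)
  then have "real q * real m \<le> real n" by (metis of_nat_le_iff of_nat_mult)
  then have "real q \<le> n / m" using m8 by (simp add: field_simps)
  then have "ln (real q) \<le> ln (n / m)" using q by (subst ln_le_cancel_iff) auto
  also have "ln (n / m) = ln n - ln m" using m8 assms by (simp add: ln_div)
  finally have harm: "1 + harm q \<le> 2 + ln n - ln m" using harm_le_Suc_ln[OF q] by simp
  \<comment> \<open>By \<open>m <= 4 * ln n\<close> the target is at most (4/13)/m. It remains to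
    keep the fraction 4/13 after the union bound, that is, to show
    \<open>1 + harm q <= 9/13 * m\<close>.\<close>
  have "inverse (13 * ln (real n)) \<le> (4 / 13) / m"
    using m_le(2) m8 by (simp add: field_simps)
  also have "(4 / 13) / m \<le> (1 - (1 + harm q) / m) / m"
  proof (rule divide_right_mono)
    have "1 + harm q \<le> 9 / 13 * real m"
    \<comment> \<open>Maximality of \<open>m\<close> means that \<open>2 * m\<close> violates one of
      the two upper bounds. If it is the logarithmic one, \<open>ln n < m / 2\<close> and
      \<open>ln m >= 2\<close> give \<open>1 + harm q <= m / 2\<close>.\<close>
    proof (cases "4 * ln n < 2 * real m")
      case True
      have "2 \<le> ln (real m)" using ln_ge_of_power2_le[of 3 m] m8 by simp
      then show ?thesis using True harm m8 by linarith
    next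
      case False
      \<comment> \<open>If the square root bound is violated, \<open>n\<close> is below 9/4 times
        the square of \<open>m\<close>, so \<open>ln n - ln m\<close> is at most
        \<open>1 + ln m\<close>.\<close>
      then have "4 * sqrt n / 3 < 2 * real m" using mb(2) by (auto simp: b_def min_def split: if_splits)
      then have "sqrt n < 3 / 2 * real m" by simp
      then have "sqrt n * sqrt n < (3 / 2 * real m) * (3 / 2 * real m)"
        by (intro mult_strict_mono) (use m8 in auto)
      then have "real n < 3 / 2 * (3 / 2) * (real m * real m)" by simp
      then have "ln (real n) \<le> ln (3 / 2 * (3 / 2) * (real m * real m))"
        using assms by (subst ln_le_cancel_iff) auto
      also have "\<dots> = 2 * ln (3 / 2) + 2 * ln (real m)"
      proof -
        have "ln (a * a * (b * b)) = 2 * ln a + 2 * ln b" if "a > 0" "b > 0" for a b :: real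
          using that by (simp add: ln_mult)
        then show ?thesis by this (use m8 in auto)
      qed
      also have "\<dots> \<le> 1 + 2 * ln (real m)"
        using ln_le_minus_one[of "3 / 2"] by simp
      finally have "1 + harm q \<le> 3 + ln (real m)" using harm by simp
      \<comment> \<open>The logarithm is expanded at 8, the least possible \<open>m\<close>, where
        its tangent bound is sharp and the required inequality is tightest.\<close>
      also have "ln (real m) = ln (real m / 8) + 3 * ln 2"
        using m8 ln_realpow[of 2 3] by (simp add: ln_div)
      also have "ln (real m / 8) \<le> real m / 8 - 1"
        using m8 by (intro ln_le_minus_one) simp
      finally show ?thesis using ln2_le_25_over_36 m8 by simp
    qed
    then show "4 / 13 \<le> 1 - (1 + harm q) / m"
      using m8 by (simp add: field_simps)
  qed simp
  finally have "inverse (13 * ln (real n)) \<le> (1 - (1 + harm q) / m) / m" .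
  then show ?thesis
    using that[of k] k3 m_le(1) n2m m8 by (simp add: m_def q_def)
qed

subsection \<open>Orders of permutations\<close>

text \<open>The power of 2 in \<open>r\<close> is strictly smaller than the one in \<open>N\<close>,
  so one more factor 2 fits and even \<open>2 * r\<close> divides \<open>N\<close>.\<close>

lemma dvd_half_of_not_pow2_dvd:
  fixes r N :: nat
  assumes "r dvd N" "2 ^ k dvd N" "\<not> 2 ^ k dvd r"
  shows "r dvd N div 2"
proof -
  have "r \<noteq> 0" using assms(3) by (metis dvd_0_right)
  then obtain j t where r: "r = 2 ^ j * t" "odd t"
    using multiplicity_decompose'[of r 2] by (metis odd_one)
  have "j < k"
  proof (rule ccontr)
    assume "\<not> j < k"
    then have "(2::nat) ^ k dvd 2 ^ j" by (simp add: le_imp_power_dvd)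
    then show False using assms(3) r by simp
  qed
  then have "2 ^ Suc j dvd N"
    using assms(2) by (meson Suc_leI dvd_trans le_imp_power_dvd)
  moreover have "t dvd N" using assms(1) r by (metis dvd_mult_right)
  ultimately have "2 ^ Suc j * t dvd N"
    using r(2) by (intro divides_mult) auto
  then have "2 * r dvd N" by (simp add: r(1) mult.assoc)
  then show ?thesis by auto
qed

lemma nat_pow_perm_group:
  assumes "mult G = (\<circ>)" "one G = id"
  shows "x [^]\<^bsub>G\<^esub> (k::nat) = x ^^ k"
  by (induction k) (simp_all add: assms funpow_Suc_right del: funpow.simps(2))

text \<open>Every cycle length divides the order, so \<open>2 ^ k\<close> does. A cycle length not
  divisible by \<open>2 ^ k\<close> then divides half the order, which makes that power fix all
  points outside the single \<open>2 ^ k\<close>-cycle.\<close>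

lemma one_cycle_perms_ord:
  assumes G: "group G" "mult G = (\<circ>)" "one G = id" and xG: "x \<in> carrier G"
    and x: "x \<in> one_cycle_perms (2 ^ k) s S" and S: "finite S" and k: "k > 0"
  shows "even (group.ord G x)"
    and "card (supp (x [^]\<^bsub>G\<^esub> (group.ord G x div 2))) \<le> 2 ^ k"
proof -
  interpret group G by (rule G(1))
  obtain A where A: "A \<subseteq> S" "card A = 2 ^ k" "\<forall>i\<in>A. least_power x i = 2 ^ k"
      "\<forall>i\<in>S - A. \<not> 2 ^ k dvd least_power x i" and xS: "x permutes S"
    using x by (auto simp: one_cycle_perms_def signed_perms_def)
  have px: "permutation x" using xS S permutation_permutes by blast
  have "x ^^ ord x = id"
    using pow_ord_eq_1[OF xG] by (simp add: nat_pow_perm_group[OF G(2,3)] G(3))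
  then have lp: "least_power x i dvd ord x" for i
    by (simp add: least_power_minimal)
  have "A \<noteq> {}" using A(2) by auto
  then have dvd: "2 ^ k dvd ord x" using lp A(3) by (metis ex_in_conv)
  then show "even (ord x)" using k by (meson dvd_power dvd_trans)
  have "supp (x ^^ (ord x div 2)) \<subseteq> A"
  proof
    fix i assume i: "i \<in> supp (x ^^ (ord x div 2))"
    then have "i \<in> S"
      using permutes_not_in[OF permutes_funpow[OF xS]] by (auto simp: supp_def)
    show "i \<in> A"
    proof (rule ccontr)
      assume "i \<notin> A"
      then have "least_power x i dvd ord x div 2"
        using A(4) \<open>i \<in> S\<close> dvd_half_of_not_pow2_dvd[OF lp dvd] by blast
      then show False
        using i least_power_dvd[OF px] by (simp add: supp_def)
    qed
  qed
  then have "card (supp (x ^^ (ord x div 2))) \<le> card A"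
    using A(1) S by (meson card_mono finite_subset)
  then show "card (supp (x [^]\<^bsub>G\<^esub> (ord x div 2))) \<le> 2 ^ k"
    by (simp add: nat_pow_perm_group[OF G(2,3)] A(2))
qed

section \<open>Passage from the sign classes to the two groups\<close>

theorem theorem1p2:
  fixes n :: nat and G :: "(nat \<Rightarrow> nat) monoid"
  assumes "n \<ge> 9"
    and "G \<in> {alt_group n, sym_group n}"
  shows "real (card {x \<in> carrier G. even (group.ord G x) \<and>
           real (card (supp (x [^]\<^bsub>G\<^esub> (group.ord G x div 2)))) \<le> 4 * sqrt (real n) / 3})
         / real (card (carrier G)) \<ge> inverse (13 * ln (real n))"
proof -
  let ?S = "{1..n}"
  define good where "good = {x \<in> carrier G. even (group.ord G x) \<and>
    real (card (supp (x [^]\<^bsub>G\<^esub> (group.ord G x div 2)))) \<le> 4 * sqrt (real n) / 3}"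
  obtain k where k: "k > 0" "real (2 ^ k) \<le> 4 * sqrt n / 3" "2 ^ k + 2 \<le> n"
    "inverse (13 * ln (real n)) \<le> (1 - (1 + harm ((n - 2 ^ k) div 2 ^ k)) / 2 ^ k) / 2 ^ k"
  proof (cases "n < 36")
    case True
    have "3 \<le> sqrt n" using assms(1) by (intro real_le_rsqrt) simp
    \<comment> \<open>The 4-cycle is admissible because \<open>n >= 9\<close> gives
      \<open>4 <= 4 * sqrt n / 3\<close>.\<close>
    then show ?thesis using that[of 2] assms(1) main_term_ge_small[OF assms(1) True] by simp
  next
    case False
    then have "36 \<le> n" by simp
    then show ?thesis
      by (rule main_term_ge_large) (rule that)
  qed
  have G: "group G" "mult G = (\<circ>)" "one G = id"
    using assms(2) by (auto simp: alt_group_is_group sym_group_is_group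
        alt_group_mult sym_group_mult alt_group_one sym_group_one)
  have m2: "2 \<le> (2::nat) ^ k" using k(1) by (cases k) auto
  have lower: "fact n / 2 * inverse (13 * ln (real n)) \<le> real (card (one_cycle_perms (2 ^ k) s ?S))"
    if "s \<in> {1, -1}" for s
  proof -
    have "fact n / 2 * inverse (13 * ln (real n))
      \<le> fact n / 2 * ((1 - (1 + harm ((n - 2 ^ k) div 2 ^ k)) / 2 ^ k) / 2 ^ k)"
      by (rule mult_left_mono[OF k(4)]) simp
    also have "\<dots> \<le> real (card (one_cycle_perms (2 ^ k) s ?S))"
      using card_one_cycle_perms_ge[of ?S s "2 ^ k"] that m2 k(3) by simp
    finally show ?thesis .
  qed
  have sub: "one_cycle_perms (2 ^ k) s ?S \<subseteq> good" if "signed_perms s ?S \<subseteq> carrier G" for s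
  proof
    fix x assume x: "x \<in> one_cycle_perms (2 ^ k) s ?S"
    then have xG: "x \<in> carrier G" using that by (auto simp: one_cycle_perms_def)
    have "real (card (supp (x [^]\<^bsub>G\<^esub> (group.ord G x div 2)))) \<le> real (2 ^ k)"
      using one_cycle_perms_ord(2)[OF G xG x _ k(1)] by (intro of_nat_mono) simp
    also note k(2)
    finally show "x \<in> good"
      using one_cycle_perms_ord(1)[OF G xG x _ k(1)] xG by (simp add: good_def)
  qed
  have fin: "finite (one_cycle_perms (2 ^ k) s ?S)" for s
    by (simp add: one_cycle_perms_def)
  from assms(2) have "inverse (13 * ln (real n)) * card (carrier G) \<le> card good"
  proof (elim insertE emptyE)
    assume alt: "G = alt_group n"
    then have carrier: "carrier G = signed_perms 1 ?S"
      by (auto simp: alt_group_carrier signed_perms_def sign_def)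
    have "2 * card (carrier G) = fact n"
      using alt_group_card_carrier[of n] assms(1) unfolding alt by simp
    then have "real (2 * card (carrier G)) = fact n"
      by (metis of_nat_fact)
    then have half: "real (card (carrier G)) = fact n / 2" by simp
    have "inverse (13 * ln (real n)) * card (carrier G) \<le> card (one_cycle_perms (2 ^ k) 1 ?S)"
      using lower[of 1] unfolding half by (simp add: mult.commute)
    also have "\<dots> \<le> real (card good)"
      using sub[of 1] finite_signed_perms[of ?S 1]
      by (intro of_nat_mono card_mono) (auto simp: carrier good_def)
    finally show ?thesis .
  next
    assume sym: "G = sym_group n"
    have carrier: "signed_perms s ?S \<subseteq> carrier G" for s
      by (auto simp: sym sym_group_carrier signed_perms_def)
    have card_carrier: "card (carrier G) = fact n" unfolding sym by (rule sym_group_card_carrier)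
    have "finite good"
      by (rule finite_subset[of _ "carrier G"])
        (auto simp: good_def sym sym_group_def finite_permutations)
    \<comment> \<open>Each sign class supplies the wanted proportion of \<open>fact n / 2\<close>;
      the two contributions are disjoint and add up to that proportion of
      \<open>fact n\<close>.\<close>
    have "inverse (13 * ln (real n)) * card (carrier G)
        \<le> real (card (one_cycle_perms (2 ^ k) 1 ?S) + card (one_cycle_perms (2 ^ k) (-1) ?S))"
      using lower[of 1] lower[of "-1"] by (simp add: card_carrier mult.commute)
    also have "\<dots> = real (card (one_cycle_perms (2 ^ k) 1 ?S \<union> one_cycle_perms (2 ^ k) (-1) ?S))"
      using fin by (subst card_Un_disjoint) (auto simp: one_cycle_perms_def signed_perms_def)
    also have "\<dots> \<le> real (card good)"
      using sub[OF carrier] \<open>finite good\<close> by (intro of_nat_mono card_mono) auto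
    finally show ?thesis .
  qed
  moreover have "card (carrier G) > 0"
  proof -
    have "finite (carrier G)"
      using assms(2) by (auto simp: alt_group_def sym_group_def finite_permutations)
    moreover have "one G \<in> carrier G"
      using G(1) by (simp add: group.is_monoid)
    ultimately show ?thesis by (auto simp: card_gt_0_iff)
  qed
  ultimately show ?thesis
    unfolding good_def[symmetric] by (simp add: pos_le_divide_eq)
qed

end
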